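(* Let $a>0$, $\Omega>0$, and let $\mathbf x\in\mathcal C^2((\alpha,\omega),\mathbb R^3)$ be a solution of $$\mathbf x\times\ddot{\mathbf x}-\Omega e_3\times\mathbf x+a\,\dot{\mathbf x}=0.$$ Then there exist constants $C,E\in\mathbb R$ such that: (i) $(\mathbf x\times\dot{\mathbf x})_3+a\,x_3=C$ for each $\xi\in(\alpha,\omega)$. (ii) $\displaystyle\frac a2\|\dot{\mathbf x}(\xi)\|^2-\Omega\,(e_3\times\mathbf x)\cdot\dot{\mathbf x}=E$ for each $\xi\in(\alpha,\omega)$.
   Context: $(\alpha,\omega)\subset\mathbb R$ is an open interval with variable $\xi$, dots denote $d/d\xi$, $e_3=(0,0,1)$, $\mathbf x=(x_1,x_2,x_3)$, $(\cdot)_3$ is the third component, and $\|\cdot\|$ is the Euclidean norm. *)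

theory Defs
  imports "HOL-Analysis.Analysis"
begin

unbundle cross3_syntax

definition e3 :: "real^3" where
  "e3 = vector [0, 0, 1]"

text \<open>Derivative with respect to the curve parameter; \<open>\<xi>\<close> will always lie in an open interval,
  so the two-sided derivative is the right one and depends only on the values there.\<close>

definition deriv_curve :: "(real \<Rightarrow> real^3) \<Rightarrow> real \<Rightarrow> real^3" where
  "deriv_curve x \<xi> = vector_derivative x (at \<xi>)"

definition C2_on :: "real set \<Rightarrow> (real \<Rightarrow> real^3) \<Rightarrow> bool" where
  "C2_on I x \<longleftrightarrow> x C1_differentiable_on I \<and> deriv_curve x C1_differentiable_on I"

text \<open>The endpoints are extended reals, so unbounded intervals are included.\<close>

definition is_solution ::
    "real \<Rightarrow> real \<Rightarrow> ereal \<Rightarrow> ereal \<Rightarrow> (real \<Rightarrow> real^3) \<Rightarrow> bool" where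
  "is_solution a \<Omega> \<alpha> \<omega> x \<longleftrightarrow>
     C2_on (einterval \<alpha> \<omega>) x \<and>
     (\<forall>\<xi>\<in>einterval \<alpha> \<omega>.
        x \<xi> \<times> deriv_curve (deriv_curve x) \<xi> - \<Omega> *\<^sub>R (e3 \<times> x \<xi>) + a *\<^sub>R deriv_curve x \<xi> = 0)"

end

theory Submission
  imports Defs
begin

text \<open>Both quantities have zero derivative along a solution, by testing the equation against
  two vectors. Write \<open>v\<close> and \<open>w\<close> for velocity and acceleration. Since
  \<open>v \<times> v = 0\<close>, the derivative of \<open>x \<times> v + a *\<^sub>R x\<close> is
  \<open>x \<times> w + a *\<^sub>R v\<close>, which the equation turns into
  \<open>\<Omega> *\<^sub>R (e3 \<times> x)\<close>, a vector orthogonal to \<open>e3\<close>; this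
  gives C. Pairing the equation with \<open>w\<close> kills \<open>x \<times> w\<close>, and what
  remains is the derivative of the energy, because \<open>(e3 \<times> v) \<bullet> v = 0\<close>;
  this gives E. Constancy on the whole interval follows from
  \<open>has_real_derivative_zero_constant_einterval\<close>.\<close>

lemma has_vector_derivative_cross3:
  assumes "(f has_vector_derivative f') (at x within S)"
    and "(g has_vector_derivative g') (at x within S)"
  shows "((\<lambda>x. f x \<times> g x) has_vector_derivative (f x \<times> g' + f' \<times> g x)) (at x within S)"
  using bounded_bilinear.has_vector_derivative[OF
    bilinear_cross[unfolded bilinear_conv_bounded_bilinear] assms] .

text \<open>Convexity is what lets a vanishing derivative force a single constant; arguing by
  betweenness treats finite and infinite endpoints alike.\<close>

lemma convex_einterval: "convex (einterval \<alpha> \<omega>)"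
proof -
  have "t \<in> einterval \<alpha> \<omega>"
    if "r \<in> einterval \<alpha> \<omega>" "s \<in> einterval \<alpha> \<omega>" "r \<le> t" "t \<le> s" for r s t
  proof -
    have "\<alpha> < ereal r" "ereal r \<le> ereal t" "ereal t \<le> ereal s" "ereal s < \<omega>"
      using that by (simp_all add: einterval_iff)
    then show ?thesis
      by (meson einterval_iff less_le_trans le_less_trans)
  qed
  then show ?thesis
    unfolding is_interval_convex_1[symmetric] is_interval_1 by blast
qed

lemma C1_differentiable_on_has_vector_derivative:
  assumes "f C1_differentiable_on S" and "t \<in> S"
  shows "(f has_vector_derivative vector_derivative f (at t)) (at t)"
  using assms by (auto simp: C1_differentiable_on_eq vector_derivative_works[symmetric])

lemma has_real_derivative_zero_constant_einterval:
  fixes f :: "real \<Rightarrow> real"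
  assumes "\<And>t. t \<in> einterval \<alpha> \<omega> \<Longrightarrow> (f has_real_derivative 0) (at t)"
  shows "\<exists>c. \<forall>t\<in>einterval \<alpha> \<omega>. f t = c"
  by (rule has_field_derivative_zero_constant[OF convex_einterval])
    (rule has_field_derivative_at_within[OF assms])

theorem proposition2p2:
  fixes a \<Omega> :: real and \<alpha> \<omega> :: ereal and x :: "real \<Rightarrow> real^3"
  assumes "a > 0" and "\<Omega> > 0" and "\<alpha> < \<omega>"
    and "is_solution a \<Omega> \<alpha> \<omega> x"
  shows "\<exists>C E :: real.
    (\<forall>\<xi>\<in>einterval \<alpha> \<omega>. (x \<xi> \<times> deriv_curve x \<xi>) $ 3 + a * x \<xi> $ 3 = C) \<and>
    (\<forall>\<xi>\<in>einterval \<alpha> \<omega>.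
       a / 2 * (norm (deriv_curve x \<xi>))\<^sup>2 - \<Omega> * ((e3 \<times> x \<xi>) \<bullet> deriv_curve x \<xi>) = E)"
proof -
  define v where "v = deriv_curve x"
  define w where "w = deriv_curve v"
  let ?I = "einterval \<alpha> \<omega>"
  have x': "(x has_vector_derivative v t) (at t)" if "t \<in> ?I" for t
    using assms(4) C1_differentiable_on_has_vector_derivative[OF _ that]
    unfolding v_def is_solution_def C2_on_def deriv_curve_def by blast
  have v': "(v has_vector_derivative w t) (at t)" if "t \<in> ?I" for t
    using assms(4) C1_differentiable_on_has_vector_derivative[OF _ that, of v]
    \<comment> \<open>Only the outer derivative is unfolded, so that the velocity stays folded as
      \<open>deriv_curve x\<close>.\<close>
    unfolding v_def w_def is_solution_def C2_on_def deriv_curve_def[of "deriv_curve x"] by blast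
  have ode: "x t \<times> w t - \<Omega> *\<^sub>R (e3 \<times> x t) + a *\<^sub>R v t = 0" if "t \<in> ?I" for t
    using assms(4) that unfolding is_solution_def v_def w_def by blast
  have "((\<lambda>t. (x t \<times> v t) $ 3 + a * x t $ 3) has_real_derivative 0) (at t)"
    if t: "t \<in> ?I" for t
  proof -
    \<comment> \<open>The component is taken last, so that the derivative is a vector to which the
      equation applies directly.\<close>
    have "((\<lambda>t. (x t \<times> v t + a *\<^sub>R x t) $ 3) has_vector_derivative
        (x t \<times> w t + v t \<times> v t + a *\<^sub>R v t) $ 3) (at t)"
      by (intro bounded_linear.has_vector_derivative[OF bounded_linear_vec_nth]
          has_vector_derivative_add has_vector_derivative_cross3 x'[OF t] v'[OF t]
          bounded_linear.has_vector_derivative[OF bounded_linear_scaleR_right])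
    moreover have "(x t \<times> w t + v t \<times> v t + a *\<^sub>R v t) $ 3 = 0"
    proof -
      have rhs: "x t \<times> w t + v t \<times> v t + a *\<^sub>R v t = \<Omega> *\<^sub>R (e3 \<times> x t)"
        using ode[OF t] by (simp add: algebra_simps)
      show ?thesis
        unfolding rhs by (simp add: cross3_def e3_def)
    qed
    ultimately show ?thesis
      by (simp add: has_real_derivative_iff_has_vector_derivative)
  qed
  from has_real_derivative_zero_constant_einterval[OF this]
  obtain C where C: "\<forall>t\<in>?I. (x t \<times> v t) $ 3 + a * x t $ 3 = C" ..
  have "((\<lambda>t. a / 2 * (norm (v t))\<^sup>2 - \<Omega> * ((e3 \<times> x t) \<bullet> v t)) has_real_derivative 0) (at t)"
    if t: "t \<in> ?I" for t
  proof -
    have "((\<lambda>t. e3 \<times> x t) has_vector_derivative e3 \<times> v t) (at t)"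
      using has_vector_derivative_cross3[OF has_vector_derivative_const x'[OF t]] by simp
    \<comment> \<open>The squared norm is written as \<open>v t \<bullet> v t\<close>, so that the
      product rule for bilinear maps covers both terms.\<close>
    then have "((\<lambda>t. a / 2 * (v t \<bullet> v t) - \<Omega> * ((e3 \<times> x t) \<bullet> v t)) has_vector_derivative
        a / 2 * (v t \<bullet> w t + w t \<bullet> v t) - \<Omega> * ((e3 \<times> x t) \<bullet> w t + (e3 \<times> v t) \<bullet> v t)) (at t)"
      by (intro has_vector_derivative_diff
          bounded_linear.has_vector_derivative[OF bounded_linear_mult_right]
          bounded_bilinear.has_vector_derivative[OF bounded_bilinear_inner] v'[OF t])
    moreover have "a / 2 * (v t \<bullet> w t + w t \<bullet> v t)
        - \<Omega> * ((e3 \<times> x t) \<bullet> w t + (e3 \<times> v t) \<bullet> v t) = 0"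
    proof -
      \<comment> \<open>Pairing with the acceleration removes the second-order term, as
        \<open>x t \<times> w t\<close> is orthogonal to \<open>w t\<close>.\<close>
      have "(x t \<times> w t - \<Omega> *\<^sub>R (e3 \<times> x t) + a *\<^sub>R v t) \<bullet> w t = 0"
        by (simp add: ode[OF t])
      then show ?thesis
        by (simp add: inner_left_distrib inner_diff_left dot_cross_self inner_commute[of "w t" "v t"])
    qed
    ultimately show ?thesis
      by (simp add: has_real_derivative_iff_has_vector_derivative power2_norm_eq_inner)
  qed
  from has_real_derivative_zero_constant_einterval[OF this]
  obtain E where E: "\<forall>t\<in>?I. a / 2 * (norm (v t))\<^sup>2 - \<Omega> * ((e3 \<times> x t) \<bullet> v t) = E" ..
  from C E show ?thesis
    unfolding v_def by blast
qed

end
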